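(* Let $a,b$ be constants and $F(x)=ax+bx^2$. Then for all integers $n\geq k\geq 1$ the composita of $F(x)$ is $$F^{\Delta}(n,k)=\binom{k}{n-k}a^{2k-n}b^{n-k}.$$
   Context: Generating functions are formal power series over a field of characteristic zero (e.g. $\mathbb{C}$). For a generating function $F(x)=\sum_{n>0}f(n)x^n$ with zero constant term, its composita is the function of two variables $F^{\Delta}(n,k)=\sum f(\lambda_1)f(\lambda_2)\cdots f(\lambda_k)$, the sum being over all compositions $(\lambda_1,\dots,\lambda_k)$ of $n$ into $k$ parts (positive integers $\lambda_i$ with $\lambda_1+\cdots+\lambda_k=n$); equivalently $F^{\Delta}(n,k)=[x^n]F(x)^k$ for $k\geq 1$. Conventions: $\binom{p}{q}=0$ for integers $p\ge 0$ and $q<0$ or $q>p$, a term containing a zero binomial coefficient is $0$, and $0^0=1$. *)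

theory Defs
  imports "HOL-Computational_Algebra.Formal_Power_Series"
begin

definition compositions :: "nat \<Rightarrow> nat \<Rightarrow> nat list set" where
  "compositions n k = {ls. length ls = k \<and> (\<forall>l\<in>set ls. l > 0) \<and> sum_list ls = n}"

lemma finite_compositions: "finite (compositions n k)"
proof (rule finite_subset)
  show "compositions n k \<subseteq> {ls. set ls \<subseteq> {..n} \<and> length ls = k}"
    by (auto simp: compositions_def member_le_sum_list)
  show "finite {ls. set ls \<subseteq> {..n} \<and> length ls = k}"
    by (rule finite_lists_length_eq) simp
qed

text \<open>
  The composita is meant for series with zero constant term; the constant term
  never enters the formula, since all parts are positive.
\<close>

definition composita :: "'a::field_char_0 fps \<Rightarrow> nat \<Rightarrow> nat \<Rightarrow> 'a" where
  "composita F n k = (\<Sum>ls\<in>compositions n k. prod_list (map (fps_nth F) ls))"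

end

theory Submission
  imports Defs
begin

text \<open>
  The composita \<open>F\<^sup>\<Delta>(n,k)\<close> is the coefficient of \<open>x\<^sup>n\<close> in \<open>F(x)\<^sup>k\<close> (lemma
  \<open>composita_eq_nth_power\<close>). Since \<open>a x + b x\<^sup>2 = x (a + b x)\<close>, that coefficient is the one of
  \<open>x\<close> to the power \<open>n - k\<close> in \<open>(a + b x)\<^sup>k\<close>, which the binomial theorem gives
  (lemma \<open>fps_nth_linear_power\<close>).
\<close>

text \<open>
  Expanding the power gives the same sum over all lists of \<open>k\<close> naturals with sum \<open>n\<close>. A list with a
  zero entry has the constant term of \<open>F\<close> as a factor, so only compositions contribute.
\<close>

lemma composita_eq_nth_power:
  fixes F :: "'a::field_char_0 fps"
  assumes "fps_nth F 0 = 0" and "1 \<le> k"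
  shows "composita F n k = fps_nth (F ^ k) n"
proof -
  have prod: "prod_list (map (fps_nth F) v) = (\<Prod>j = 0..k - 1. fps_nth F (v ! j))"
    if "length v = k" for v
  proof -
    have "{0..k - 1} = {0..<length v}"
      using that \<open>1 \<le> k\<close> by auto
    then show ?thesis
      by (simp add: prod.list_conv_set_nth)
  qed
  have "composita F n k = (\<Sum>v\<in>natpermute n k. prod_list (map (fps_nth F) v))"
    unfolding composita_def
  proof (rule sum.mono_neutral_left)
    show "finite (natpermute n k)"
      by (rule natpermute_finite)
    show "compositions n k \<subseteq> natpermute n k"
      by (auto simp: compositions_def natpermute_def)
    show "\<forall>v\<in>natpermute n k - compositions n k. prod_list (map (fps_nth F) v) = 0"
      using \<open>fps_nth F 0 = 0\<close> by (force simp: compositions_def natpermute_def prod_list_zero_iff)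
  qed
  also have "\<dots> = (\<Sum>v\<in>natpermute n k. \<Prod>j = 0..k - 1. fps_nth F (v ! j))"
    by (rule sum.cong) (auto simp: natpermute_def prod)
  also have "\<dots> = fps_nth (F ^ k) n"
    using \<open>1 \<le> k\<close> by (simp add: fps_power_nth)
  finally show ?thesis .
qed

lemma fps_nth_linear_power:
  fixes a b :: "'a::comm_ring_1"
  shows "fps_nth ((fps_const a + fps_const b * fps_X) ^ k) m = of_nat (k choose m) * a ^ (k - m) * b ^ m"
proof -
  have "(fps_const a + fps_const b * fps_X) ^ k
      = (\<Sum>i\<le>k. fps_const (of_nat (k choose i) * b ^ i * a ^ (k - i)) * fps_X ^ i)"
    by (subst add.commute, subst binomial_ring)
       (simp add: power_mult_distrib fps_of_nat fps_const_power mult_ac flip: fps_const_mult)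
  then have "fps_nth ((fps_const a + fps_const b * fps_X) ^ k) m
      = (\<Sum>i\<le>k. if i = m then of_nat (k choose i) * b ^ i * a ^ (k - i) else 0)"
    by (simp add: fps_sum_nth if_distrib eq_commute cong: if_cong)
  then show ?thesis
    by (simp add: binomial_eq_0 mult_ac)
qed

theorem mainTheorem2:
  fixes a b :: "'a::field_char_0" and n k :: nat
  assumes "1 \<le> k" and "k \<le> n"
  shows "composita (fps_const a * fps_X + fps_const b * fps_X ^ 2) n k =
           of_nat (k choose (n - k)) * a powi (2 * int k - int n) * b ^ (n - k)"
proof -
  let ?F = "fps_const a * fps_X + fps_const b * fps_X ^ 2"
  have "?F = fps_X * (fps_const a + fps_const b * fps_X)"
    by (simp add: algebra_simps power2_eq_square)
  then have "?F ^ k = fps_X ^ k * (fps_const a + fps_const b * fps_X) ^ k"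
    by (simp only: power_mult_distrib)
  then have "composita ?F n k = fps_nth ((fps_const a + fps_const b * fps_X) ^ k) (n - k)"
    using assms by (simp add: composita_eq_nth_power fps_X_power_mult_nth)
  also have "\<dots> = of_nat (k choose (n - k)) * a ^ (k - (n - k)) * b ^ (n - k)"
    by (rule fps_nth_linear_power)
  also have "\<dots> = of_nat (k choose (n - k)) * a powi (2 * int k - int n) * b ^ (n - k)"
  proof (cases "n - k \<le> k")
    case True
    then have "2 * int k - int n = int (k - (n - k))"
      using assms by simp
    then show ?thesis
      by (simp only: power_int_of_nat)
  next
    \<comment> \<open>Here truncated and integer subtraction give different exponents of \<open>a\<close>, but the binomial
      coefficient vanishes.\<close>
    case False
    then show ?thesis
      by (simp add: binomial_eq_0)
  qed
  finally show ?thesis .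
qed

end
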